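(* Let $q\in\mathbb{C}$ with $0<|q|<1$, and let $\mathcal{T}_n=\mathcal{T}_n(x,s,q)$ be the $q$-Chebyshev polynomials of the first kind. Then the generating function $S(z)=\sum_{n=0}^{\infty}\mathcal{T}_n(x,s,q)\,z^n$ is $$S(z)=\frac{1-xz}{1-xz-(xz+sqz^{2})\,\eta_z},$$ that is, $\bigl(1-xz-(xz+sqz^2)\eta_z\bigr)S(z)=1-xz$.
   Context: The $q$-Chebyshev polynomials of the first kind are defined by $\mathcal{T}_0(x,s,q)=1$, $\mathcal{T}_1(x,s,q)=x$ and $$\mathcal{T}_{n}(x,s,q)=(1+q^{n-1})x\,\mathcal{T}_{n-1}(x,s,q)+q^{n-1}s\,\mathcal{T}_{n-2}(x,s,q)\qquad(n\ge 2),$$ where $x,s$ are indeterminates. Power series in $z$ are formal. $\eta_z$ is the operator on functions (formal power series) of $z$ defined by $\eta_z(f(z))=f(qz)$; an expression such as $(xz+sqz^2)\eta_z$ means: first apply $\eta_z$, then multiply by $xz+sqz^2$. The notation $\frac{f}{L}$, for an operator $L=1-a(z)-b(z)\,\eta_z$ on formal power series in $z$, where $a(z),b(z)$ are polynomials in $z$ with zero constant term acting by multiplication, and a series $f$, denotes the power series $S$ with $LS=f$. *)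

theory Defs
  imports Complex_Main "HOL-Computational_Algebra.Polynomial" "HOL-Computational_Algebra.Formal_Power_Series"
begin

fun q_chebyshev_T :: "nat \<Rightarrow> 'a::comm_ring_1 \<Rightarrow> 'a \<Rightarrow> 'a \<Rightarrow> 'a" where
  "q_chebyshev_T 0 x s q = 1"
| "q_chebyshev_T (Suc 0) x s q = x"
| "q_chebyshev_T (Suc (Suc n)) x s q =
     (1 + q ^ Suc n) * x * q_chebyshev_T (Suc n) x s q + q ^ Suc n * s * q_chebyshev_T n x s q"

text \<open>The polynomial ring in the two indeterminates \<open>x\<close> and \<open>s\<close> over the complex numbers is
  rendered as the iterated polynomial ring: \<open>x\<close> is the inner variable, \<open>s\<close> the outer one.\<close>

definition indet_x :: "complex poly poly" where
  "indet_x = [:[:0, 1:]:]"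

definition indet_s :: "complex poly poly" where
  "indet_s = [:0, 1:]"

definition scalar :: "complex \<Rightarrow> complex poly poly" where
  "scalar c = [:[:c:]:]"

text \<open>The substitution \<open>f(z) \<mapsto> f(q z)\<close>.\<close>

definition eta :: "'a::comm_ring_1 \<Rightarrow> 'a fps \<Rightarrow> 'a fps" where
  "eta q f = fps_compose f (fps_const q * fps_X)"

text \<open>The operator \<open>1 - a(z) - b(z) \<eta>\<close>, where \<open>a\<close> and \<open>b\<close> act by multiplication.\<close>

definition eta_op :: "'a::comm_ring_1 \<Rightarrow> 'a fps \<Rightarrow> 'a fps \<Rightarrow> 'a fps \<Rightarrow> 'a fps" where
  "eta_op q a b F = F - a * F - b * eta q F"

text \<open>The quotient \<open>f / L\<close> of a series by an operator; it is meaningful only if \<open>L S = f\<close> has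
  exactly one solution \<open>S\<close>, which \<open>eta_op_ex1\<close> below guarantees for the operators above when
  \<open>a\<close> and \<open>b\<close> have zero constant term.\<close>

definition op_divide :: "'a::comm_ring_1 fps \<Rightarrow> ('a fps \<Rightarrow> 'a fps) \<Rightarrow> 'a fps" where
  "op_divide f L = (THE S. L S = f)"

lemma eta_op_nth:
  fixes a b :: "'a::comm_ring_1 fps"
  assumes "fps_nth a 0 = 0" and "fps_nth b 0 = 0"
  shows "fps_nth (eta_op q a b F) n = fps_nth F n -
    (\<Sum>i=1..n. (fps_nth a i + fps_nth b i * q ^ (n - i)) * fps_nth F (n - i))"
proof -
  have "(\<Sum>i=0..n. fps_nth a i * fps_nth F (n - i)) =
      (\<Sum>i=1..n. fps_nth a i * fps_nth F (n - i))"
    and "(\<Sum>i=0..n. fps_nth b i * (q ^ (n - i) * fps_nth F (n - i))) =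
      (\<Sum>i=1..n. fps_nth b i * (q ^ (n - i) * fps_nth F (n - i)))"
    using assms by (simp_all add: sum.atLeast_Suc_atMost)
  then show ?thesis
    by (simp add: eta_op_def eta_def fps_mult_nth sum.distrib distrib_right mult.assoc)
qed

fun eta_op_sol :: "'a::comm_ring_1 \<Rightarrow> 'a fps \<Rightarrow> 'a fps \<Rightarrow> 'a fps \<Rightarrow> nat \<Rightarrow> 'a" where
  "eta_op_sol q a b f n = fps_nth f n +
    (\<Sum>i=1..n. (fps_nth a i + fps_nth b i * q ^ (n - i)) * eta_op_sol q a b f (n - i))"

declare eta_op_sol.simps [simp del]

lemma eta_op_ex1:
  fixes a b :: "'a::comm_ring_1 fps"
  assumes "fps_nth a 0 = 0" and "fps_nth b 0 = 0"
  shows "\<exists>!S. eta_op q a b S = f"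
proof (rule ex1I)
  show "eta_op q a b (Abs_fps (eta_op_sol q a b f)) = f"
  proof (rule fps_ext)
    fix n
    show "fps_nth (eta_op q a b (Abs_fps (eta_op_sol q a b f))) n = fps_nth f n"
      using eta_op_sol.simps[of q a b f n] by (simp add: eta_op_nth[OF assms])
  qed
next
  fix S assume S: "eta_op q a b S = f"
  have "fps_nth S n = eta_op_sol q a b f n" for n
  proof (induction n rule: less_induct)
    case (less n)
    have "fps_nth S n = fps_nth f n +
      (\<Sum>i=1..n. (fps_nth a i + fps_nth b i * q ^ (n - i)) * fps_nth S (n - i))"
      using eta_op_nth[OF assms, of q S n] S by (simp add: algebra_simps)
    also have "\<dots> = eta_op_sol q a b f n"
      unfolding eta_op_sol.simps[of q a b f n]
      by (intro arg_cong2[where f = "(+)"] refl sum.cong arg_cong2[where f = "(*)"] less) auto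
    finally show ?case .
  qed
  then show "S = Abs_fps (eta_op_sol q a b f)"
    by (intro fps_ext) simp
qed

end

theory Submission
  imports Defs
begin

text \<open>The operator equation is the recurrence read coefficientwise: since \<open>\<eta>\<close> multiplies the
  coefficient of \<open>z ^ n\<close> by \<open>q ^ n\<close>, the coefficient of \<open>z ^ (n + 2)\<close> in \<open>L S\<close> is
  \<open>T (n + 2) - (1 + q ^ (n + 1)) * x * T (n + 1) - q ^ (n + 1) * s * T n = 0\<close>, and the coefficients
  of \<open>z ^ 0\<close> and \<open>z ^ 1\<close> are \<open>1\<close> and \<open>x - 2 * x = - x\<close>. This holds over every commutative ring.
  The quotient is then \<open>S\<close> because, by \<open>eta_op_ex1\<close>, the equation \<open>L S = 1 - x * z\<close> has only one
  solution.\<close>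

lemma eta_nth [simp]: "fps_nth (eta q F) n = q ^ n * fps_nth F n"
  by (simp add: eta_def)

lemma eta_op_q_chebyshev_T:
  fixes x s q :: "'a::comm_ring_1"
  defines "xz \<equiv> fps_const x * fps_X"
    and "sqz2 \<equiv> fps_const (s * q) * fps_X ^ 2"
  shows "eta_op q xz (xz + sqz2) (Abs_fps (\<lambda>n. q_chebyshev_T n x s q)) = 1 - xz"
proof (rule fps_ext)
  fix n
  have xz_nth: "fps_nth (xz * F) n = (if n = 0 then 0 else x * fps_nth F (n - 1))" for F
    by (simp add: xz_def mult.assoc)
  have sqz2_nth: "fps_nth (sqz2 * F) n = (if n < 2 then 0 else s * q * fps_nth F (n - 2))" for F
    by (simp add: sqz2_def mult.assoc fps_X_power_mult_nth)
  consider "n = 0" | "n = 1" | m where "n = Suc (Suc m)"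
    by (metis One_nat_def not0_implies_Suc)
  then show "fps_nth (eta_op q xz (xz + sqz2) (Abs_fps (\<lambda>n. q_chebyshev_T n x s q))) n
      = fps_nth (1 - xz) n"
    unfolding eta_op_def distrib_right fps_sub_nth fps_add_nth xz_nth sqz2_nth
    by cases (simp_all add: xz_def algebra_simps)
qed

theorem theorem2:
  fixes q :: complex and xz sqz2 S :: "complex poly poly fps"
    and L :: "complex poly poly fps \<Rightarrow> complex poly poly fps"
  assumes "0 < norm q" and "norm q < 1"
  defines "xz \<equiv> fps_const indet_x * fps_X"
    and "sqz2 \<equiv> fps_const (indet_s * scalar q) * fps_X ^ 2"
    and "S \<equiv> Abs_fps (\<lambda>n. q_chebyshev_T n indet_x indet_s (scalar q))"
    and "L \<equiv> eta_op (scalar q) xz (xz + sqz2)"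
  shows "S = op_divide (1 - xz) L \<and> L S = 1 - xz"
proof -
  have LS: "L S = 1 - xz"
    unfolding L_def S_def xz_def sqz2_def by (rule eta_op_q_chebyshev_T)
  have "fps_nth xz 0 = 0" and "fps_nth (xz + sqz2) 0 = 0"
    by (simp_all add: xz_def sqz2_def)
  then have "\<exists>!F. L F = 1 - xz"
    unfolding L_def by (rule eta_op_ex1)
  then have "op_divide (1 - xz) L = S"
    unfolding op_divide_def using LS by (rule the1_equality)
  with LS show ?thesis by simp
qed

end
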